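(* In the setting described in the context, assume that the linear equation $x(m+1)=A_mx_m$, $m\in\mathbb{Z}^+$, admits a uniform exponential dichotomy with projections $(P_n)_{n\in\mathbb{Z}^+}$ and constants $D,\lambda>0$. Then there exists $C_0>0$ such that, whenever $0<C<C_0$ and $f_m:\mathcal{B}\to X$, $m\in\mathbb{Z}^+$, are maps with $f_m(0)=0$ and $|f_m(\phi)-f_m(\psi)|\le C\min(1,\|\phi-\psi\|_{\mathcal{B}})$ for all $m\in\mathbb{Z}^+$ and $\phi,\psi\in\mathcal{B}$, one has $$K(1)\,\sup_{m\in\mathbb{Z}^+}\Big(\sum_{n\in\mathbb{Z}^+}C\,\|\mathcal{G}(m,n+1)\|\Big)<1,$$ and consequently there exists $\eta\in\mathcal{M}$ such that, writing $h^n=\mathrm{Id}_{F_n}+\eta(n,\cdot):F_n\to\mathcal{B}$, one has $h^m\circ\mathcal{A}(m,n)=\mathcal{R}(m,n)\circ h^n$ on $F_n$ for every $m\ge n\ge0$, and each $h^n$ is one-to-one.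
   Context: $\mathbb{Z}^+$ and $\mathbb{Z}^-$ denote the sets of nonnegative and nonpositive integers. $(X,|\cdot|)$ is a Banach space. For $x:\mathbb{Z}\to X$ and $m\in\mathbb{Z}$, define $x_m:\mathbb{Z}^-\to X$ by $x_m(j)=x(m+j)$. Phase space: $(\mathcal{B},\|\cdot\|_{\mathcal{B}})$ is a Banach space of sequences $\phi:\mathbb{Z}^-\to X$ satisfying assumption (A): there exist $J>0$ and $K,M:\mathbb{Z}^+\to[0,\infty)$ such that if $x:\mathbb{Z}\to X$ has $x_0\in\mathcal{B}$, then for all $n\in\mathbb{Z}^+$, $x_n\in\mathcal{B}$ and $J|x(n)|\le\|x_n\|_{\mathcal{B}}\le K(n)\sup_{0\le j\le n}|x(j)|+M(n)\|x_0\|_{\mathcal{B}}$. Such $J,K,M$ are fixed. Linear equation: $A_m:\mathcal{B}\to X$, $m\in\mathbb{Z}^+$, are linear operators, and one considers $x(m+1)=A_mx_m$, $m\in\mathbb{Z}^+$. For $(n,\phi)\in\mathbb{Z}^+\times\mathcal{B}$ let $x(\cdot;n,\phi):\mathbb{Z}\to X$ be the unique sequence with $x_n=\phi$ satisfying the equation for all $m\ge n$. For $m\ge n\ge0$ define $\mathcal{A}(m,n):\mathcal{B}\to\mathcal{B}$ by $\mathcal{A}(m,n)\phi=x_m(\cdot;n,\phi)$. Uniform exponential dichotomy: for each $n\in\mathbb{Z}^+$ there is a projection $P_n$ on $\mathcal{B}$ such that (1) $\mathcal{A}(m,n)P_n=P_m\mathcal{A}(m,n)$ for all $m\ge n\ge0$;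 (2) for $m\ge n$, $\mathcal{A}(m,n)|_{\ker P_n}:\ker P_n\to\ker P_m$ is invertible, with inverse denoted $\mathcal{A}(n,m):\ker P_m\to\ker P_n$; (3) there exist $D,\lambda>0$ with $\|\mathcal{A}(m,n)P_n\|\le De^{-\lambda(m-n)}$ for all $m\ge n$ and $\|\mathcal{A}(m,n)(\mathrm{Id}_{\mathcal{B}}-P_n)\|\le De^{-\lambda(n-m)}$ for all $m<n$. Put $Q_n=\mathrm{Id}_{\mathcal{B}}-P_n$ and let $F_n$ be the range of $Q_n$ (so $F_n=\ker P_n$). Green operator: for $m,n\in\mathbb{Z}^+$, $\mathcal{G}(m,n)=\mathcal{A}(m,n)P_n$ if $m\ge n$, and $\mathcal{G}(m,n)=-\mathcal{A}(m,n)Q_n$ if $m<n$. $\|\mathcal{G}(m,n)\|$ is the operator norm on $\mathcal{B}$. Space $\mathcal{M}$: the set of continuous functions $\eta:\{(n,\phi):n\in\mathbb{Z}^+,\phi\in F_n\}\to\mathcal{B}$ with $\sup\{\|\eta(n,\phi)\|_{\mathcal{B}}:n\in\mathbb{Z}^+,\phi\in F_n\}<\infty$. Semilinear equation: $x(m+1)=A_mx_m+f_m(x_m)$, $m\in\mathbb{Z}^+$. For $m\ge n\ge0$, $\mathcal{R}(m,n):\mathcal{B}\to\mathcal{B}$ is its solution operator: $\mathcal{R}(m,n)\phi=x_m$, where $x:\mathbb{Z}\to X$ is the unique sequence with $x_n=\phi$ satisfying the semilinear equation at all indices $\ge n$. *)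

theory Defs
  imports "HOL-Analysis.Analysis"
begin

text \<open>
  The phase space is a Banach space type \<open>'b\<close> together with a map \<open>ev\<close> presenting its elements
  as sequences: \<open>ev \<phi> j\<close> is the entry of \<open>\<phi>\<close> at the nonpositive integer \<open>j\<close>. The values of
  \<open>ev \<phi>\<close> at positive integers carry no meaning and are never used.
\<close>

definition segment_of :: "('b \<Rightarrow> int \<Rightarrow> 'a) \<Rightarrow> (int \<Rightarrow> 'a) \<Rightarrow> int \<Rightarrow> 'b \<Rightarrow> bool" where
  "segment_of ev x m \<phi> \<longleftrightarrow> (\<forall>j\<le>0. ev \<phi> j = x (m + j))"

definition in_phase :: "('b \<Rightarrow> int \<Rightarrow> 'a) \<Rightarrow> (int \<Rightarrow> 'a) \<Rightarrow> int \<Rightarrow> bool" where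
  "in_phase ev x m \<longleftrightarrow> (\<exists>\<phi>. segment_of ev x m \<phi>)"

text \<open>The segment \<open>x\<^sub>m\<close> as an element of the phase space; meaningful when \<open>in_phase ev x m\<close>.\<close>

definition seg :: "('b \<Rightarrow> int \<Rightarrow> 'a) \<Rightarrow> (int \<Rightarrow> 'a) \<Rightarrow> int \<Rightarrow> 'b" where
  "seg ev x m = (THE \<phi>. segment_of ev x m \<phi>)"

text \<open>
  The first two assumptions say that \<open>'b\<close> is, via \<open>ev\<close>, a vector space of sequences (with
  pointwise operations) indexed by the nonpositive integers.
\<close>

locale phase_space =
  fixes ev :: "'b::banach \<Rightarrow> int \<Rightarrow> 'a::banach"
    and J :: real and K M :: "nat \<Rightarrow> real"
  assumes ev_linear: "\<And>j. j \<le> 0 \<Longrightarrow> linear (\<lambda>\<phi>. ev \<phi> j)"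
    and ev_inject: "\<And>\<phi> \<psi>. (\<And>j. j \<le> 0 \<Longrightarrow> ev \<phi> j = ev \<psi> j) \<Longrightarrow> \<phi> = \<psi>"
    and J_pos: "J > 0"
    and K_nonneg: "\<And>n. K n \<ge> 0"
    and M_nonneg: "\<And>n. M n \<ge> 0"
    and in_phase_forward: "\<And>x n. in_phase ev x 0 \<Longrightarrow> in_phase ev x (int n)"
    and norm_seg_lower: "\<And>x n. in_phase ev x 0 \<Longrightarrow> J * norm (x (int n)) \<le> norm (seg ev x (int n))"
    and norm_seg_upper: "\<And>x n. in_phase ev x 0 \<Longrightarrow>
      norm (seg ev x (int n)) \<le> K n * (SUP j\<in>{0..int n}. norm (x j)) + M n * norm (seg ev x 0)"

text \<open>
  \<open>x\<close> solves \<open>x(m+1) = g\<^sub>m(x\<^sub>m)\<close> for all \<open>m \<ge> n\<close> with \<open>x\<^sub>n = \<phi>\<close>. Both the linear and the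
  semilinear equation are instances.
\<close>

definition solves ::
  "('b \<Rightarrow> int \<Rightarrow> 'a) \<Rightarrow> (nat \<Rightarrow> 'b \<Rightarrow> 'a) \<Rightarrow> nat \<Rightarrow> 'b \<Rightarrow> (int \<Rightarrow> 'a) \<Rightarrow> bool" where
  "solves ev g n \<phi> x \<longleftrightarrow>
     segment_of ev x (int n) \<phi> \<and> (\<forall>m\<ge>n. x (int m + 1) = g m (seg ev x (int m)))"

definition solution ::
  "('b \<Rightarrow> int \<Rightarrow> 'a) \<Rightarrow> (nat \<Rightarrow> 'b \<Rightarrow> 'a) \<Rightarrow> nat \<Rightarrow> 'b \<Rightarrow> int \<Rightarrow> 'a" where
  "solution ev g n \<phi> = (THE x. solves ev g n \<phi> x)"

text \<open>The solution operator; meaningful for \<open>m \<ge> n\<close>.\<close>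

definition sol_op ::
  "('b \<Rightarrow> int \<Rightarrow> 'a) \<Rightarrow> (nat \<Rightarrow> 'b \<Rightarrow> 'a) \<Rightarrow> nat \<Rightarrow> nat \<Rightarrow> 'b \<Rightarrow> 'b" where
  "sol_op ev g m n \<phi> = seg ev (solution ev g n \<phi>) (int m)"

definition kerP :: "(nat \<Rightarrow> 'b \<Rightarrow> 'b::real_vector) \<Rightarrow> nat \<Rightarrow> 'b set" where
  "kerP P n = {\<phi>. P n \<phi> = 0}"

definition Qproj :: "(nat \<Rightarrow> 'b \<Rightarrow> 'b::real_vector) \<Rightarrow> nat \<Rightarrow> 'b \<Rightarrow> 'b" where
  "Qproj P n \<phi> = \<phi> - P n \<phi>"

definition Fsp :: "(nat \<Rightarrow> 'b \<Rightarrow> 'b::real_vector) \<Rightarrow> nat \<Rightarrow> 'b set" where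
  "Fsp P n = range (Qproj P n)"

text \<open>
  The operators \<open>\<A>(m,n)\<close> for arbitrary \<open>m, n\<close>: for \<open>m < n\<close> this is the inverse of
  \<open>\<A>(n,m)\<close> restricted to \<open>ker P\<^sub>m \<rightarrow> ker P\<^sub>n\<close>, meaningful on \<open>ker P\<^sub>n\<close> only.
\<close>

definition evol ::
  "('b::real_vector \<Rightarrow> int \<Rightarrow> 'a) \<Rightarrow> (nat \<Rightarrow> 'b \<Rightarrow> 'a) \<Rightarrow> (nat \<Rightarrow> 'b \<Rightarrow> 'b) \<Rightarrow> nat \<Rightarrow> nat \<Rightarrow> 'b \<Rightarrow> 'b"
  where
  "evol ev A P m n =
     (if n \<le> m then sol_op ev A m n else inv_into (kerP P m) (sol_op ev A n m))"

text \<open>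
  \<open>onorm\<close> is the operator norm only for bounded operators, so each norm bound is accompanied by
  the boundedness it presupposes. For \<open>m = n\<close> this includes boundedness of \<open>P n\<close>.
\<close>

definition uniform_exp_dichotomy ::
  "('b::real_normed_vector \<Rightarrow> int \<Rightarrow> 'a) \<Rightarrow> (nat \<Rightarrow> 'b \<Rightarrow> 'a) \<Rightarrow> (nat \<Rightarrow> 'b \<Rightarrow> 'b) \<Rightarrow> real \<Rightarrow> real \<Rightarrow> bool"
  where
  "uniform_exp_dichotomy ev A P D lam \<longleftrightarrow>
     D > 0 \<and> lam > 0 \<and>
     (\<forall>n. linear (P n) \<and> P n \<circ> P n = P n) \<and>
     (\<forall>m n. n \<le> m \<longrightarrow> sol_op ev A m n \<circ> P n = P m \<circ> sol_op ev A m n) \<and>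
     (\<forall>m n. n \<le> m \<longrightarrow> bij_betw (sol_op ev A m n) (kerP P n) (kerP P m)) \<and>
     (\<forall>m n. n \<le> m \<longrightarrow>
        bounded_linear (evol ev A P m n \<circ> P n) \<and>
        onorm (evol ev A P m n \<circ> P n) \<le> D * exp (- lam * (real m - real n))) \<and>
     (\<forall>m n. m < n \<longrightarrow>
        bounded_linear (evol ev A P m n \<circ> Qproj P n) \<and>
        onorm (evol ev A P m n \<circ> Qproj P n) \<le> D * exp (- lam * (real n - real m)))"

definition green ::
  "('b::real_vector \<Rightarrow> int \<Rightarrow> 'a) \<Rightarrow> (nat \<Rightarrow> 'b \<Rightarrow> 'a) \<Rightarrow> (nat \<Rightarrow> 'b \<Rightarrow> 'b) \<Rightarrow> nat \<Rightarrow> nat \<Rightarrow> 'b \<Rightarrow> 'b"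
  where
  "green ev A P m n \<phi> =
     (if n \<le> m then evol ev A P m n (P n \<phi>) else - evol ev A P m n (Qproj P n \<phi>))"

text \<open>
  The function space \<open>\<M>\<close>; only the values on the indicated domain matter. The product
  topology on \<open>nat \<times> 'b\<close> has the discrete topology on the first factor.
\<close>

definition Mspace :: "(nat \<Rightarrow> 'b \<Rightarrow> 'b::real_normed_vector) \<Rightarrow> (nat \<times> 'b \<Rightarrow> 'b) set" where
  "Mspace P = {\<eta>. continuous_on (SIGMA n:UNIV. Fsp P n) \<eta> \<and>
                  bounded (\<eta> ` (SIGMA n:UNIV. Fsp P n))}"

context phase_space
begin

lemma seg_eqI: "segment_of ev x m \<phi> \<Longrightarrow> seg ev x m = \<phi>"
  unfolding seg_def segment_of_def by (rule the_equality) (auto intro: ev_inject)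

lemma in_phase_later:
  assumes "in_phase ev x m"
  shows "in_phase ev x (m + int k)"
proof -
  have "in_phase ev (\<lambda>i. x (m + i)) 0"
    using assms by (auto simp: in_phase_def segment_of_def)
  from in_phase_forward[OF this, of k] show ?thesis
    by (auto simp: in_phase_def segment_of_def add.assoc)
qed

lemma seg_cong:
  assumes "\<And>i. i \<le> m \<Longrightarrow> x i = y i"
  shows "seg ev x m = seg ev y m"
proof -
  have "segment_of ev x m = segment_of ev y m"
    using assms by (auto simp: segment_of_def fun_eq_iff)
  then show ?thesis by (simp add: seg_def)
qed

lemma ex1_solution: "\<exists>!x. solves ev g n \<phi> x"
proof (rule ex_ex1I)
  define y where "y = rec_nat (\<lambda>i. ev \<phi> (i - int n))
    (\<lambda>k z. z(int n + int k + 1 := g (n + k) (seg ev z (int n + int k))))"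
  have y0: "y 0 = (\<lambda>i. ev \<phi> (i - int n))" by (simp add: y_def)
  have yS: "y (Suc k) = (y k)(int n + int k + 1 := g (n + k) (seg ev (y k) (int n + int k)))" for k
    by (simp add: y_def)
  have stable: "y (k + d) i = y k i" if "i \<le> int n + int k" for i k d
    using that by (induction d) (auto simp: yS)
  define x where "x = (\<lambda>i. y (nat (i - int n)) i)"
  have x_eq: "x i = y k i" if "i \<le> int n + int k" for i k
  proof -
    have "nat (i - int n) \<le> k" using that by linarith
    then obtain d where "k = nat (i - int n) + d" using le_Suc_ex by blast
    then show ?thesis using stable[of i "nat (i - int n)" d] by (simp add: x_def)
  qed
  have "solves ev g n \<phi> x"
    unfolding solves_def
  proof (intro conjI allI impI)
    show "segment_of ev x (int n) \<phi>"
      unfolding segment_of_def using x_eq[of _ 0] by (auto simp: y0)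
  next
    fix m assume "n \<le> m"
    then obtain k where k: "m = n + k" using le_Suc_ex by blast
    have "x (int m + 1) = y (Suc k) (int m + 1)" by (rule x_eq) (simp add: k)
    also have "\<dots> = g m (seg ev (y k) (int m))" by (simp add: yS k)
    also have "seg ev (y k) (int m) = seg ev x (int m)"
      by (rule seg_cong) (simp add: x_eq[of _ k] k)
    finally show "x (int m + 1) = g m (seg ev x (int m))" .
  qed
  then show "\<exists>x. solves ev g n \<phi> x" by blast
next
  fix x y assume x: "solves ev g n \<phi> x" and y: "solves ev g n \<phi> y"
  have agree: "\<forall>i\<le>int n + int k. x i = y i" for k
  proof (induction k)
    case 0
    show ?case
    proof (intro allI impI)
      fix i assume "i \<le> int n + int 0"
      then have "i - int n \<le> 0" by simp
      then have "ev \<phi> (i - int n) = x (int n + (i - int n))"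
        and "ev \<phi> (i - int n) = y (int n + (i - int n))"
        using x y unfolding solves_def segment_of_def by blast+
      then show "x i = y i" by simp
    qed
  next
    case (Suc k)
    have "seg ev x (int (n + k)) = seg ev y (int (n + k))"
      by (rule seg_cong) (use Suc in simp)
    moreover have "x (int (n + k) + 1) = g (n + k) (seg ev x (int (n + k)))"
      and "y (int (n + k) + 1) = g (n + k) (seg ev y (int (n + k)))"
      using x y le_add1[of n k] unfolding solves_def by blast+
    ultimately have eq: "x (int (n + k) + 1) = y (int (n + k) + 1)" by simp
    show ?case
    proof (intro allI impI)
      fix i assume "i \<le> int n + int (Suc k)"
      then consider "i \<le> int n + int k" | "i = int (n + k) + 1" by fastforce
      then show "x i = y i" using Suc eq by cases auto
    qed
  qed
  show "x = y"
  proof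
    fix i
    show "x i = y i" using agree[of "nat (i - int n)"] by auto
  qed
qed

end

end

theory Submission
  imports Defs
begin

text \<open>
  Appending a value to a segment turns the delay equation into a one-step recursion on the phase
  space: \<open>x\<^bsub>m+1\<^esub> = U(m+1,m) x\<^sub>m + \<Gamma>(f\<^sub>m(x\<^sub>m))\<close>, where \<open>U = \<A>\<close> is the linear evolution and
  \<open>\<Gamma> v\<close> (below \<open>kick v\<close>) is the segment with value \<open>v\<close> at \<open>0\<close> and zero before; by assumption (A),
  \<open>\<parallel>\<Gamma> v\<parallel> \<le> K(1) |v|\<close>. The Green operator is the bounded right inverse of the linear part:
  \<open>\<G>(n+1,k+1) = U(n+1,n) \<G>(n,k+1) + \<delta>\<^bsub>kn\<^esub> Id\<close> (\<open>green_step\<close>), so \<open>z\<^sub>n = \<Sum>\<^sub>k \<G>(n,k+1) w\<^sub>k\<close> solves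
  \<open>z\<^bsub>n+1\<^esub> = U(n+1,n) z\<^sub>n + w\<^sub>n\<close> for every bounded \<open>w\<close> (\<open>suminf_green_step\<close>).

  A vector \<open>\<phi> \<in> F\<^sub>n\<close> lies on a whole linear orbit \<open>k \<mapsto> \<A>(k,n)\<phi>\<close>, backwards as well as forwards.
  Looking for a bounded correction \<open>\<eta>\<close> that turns each such orbit into an orbit of the semilinear
  equation therefore leads to the fixed point equation
  \<open>\<eta>(n,\<phi>) = \<Sum>\<^sub>k \<G>(n,k+1) \<Gamma> f\<^sub>k(\<A>(k,n)\<phi> + \<eta>(k,\<A>(k,n)\<phi>))\<close>.
  Its right-hand side is bounded because \<open>|f\<^sub>k| \<le> C\<close>, and it is a contraction in the supremum norm
  with constant \<open>K(1) C S\<close>, where \<open>S = 2D/(1 - e\<^bsup>-\<lambda>\<^esup>)\<close> dominates \<open>\<Sum>\<^sub>k \<parallel>\<G>(n,k+1)\<parallel>\<close>; this gives the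
  choice \<open>C\<^sub>0 = 1/(K(1) S + 1)\<close>. Since the linear orbit through \<open>\<A>(n+1,n)\<phi>\<close> is the one through
  \<open>\<phi>\<close>, the Green identity yields the conjugacy (\<open>fixpoint_conjugates\<close>).

  The delicate point is that \<open>\<eta>\<close> has to be continuous, although the linear maps \<open>A\<^sub>m\<close> are not
  assumed to be bounded. The dichotomy bounds \<open>U(m,n)\<close> on the range of \<open>P\<^sub>n\<close> and its inverse on
  \<open>ker P\<^sub>m\<close>; the closed graph theorem turns the latter into boundedness of \<open>U(m,n)\<close> on \<open>ker P\<^sub>n\<close>.

  For injectivity, two points of \<open>F\<^sub>n\<close> with the same image have linear orbits that stay within
  \<open>2 sup \<parallel>\<eta>\<parallel>\<close> of each other for all future times; on \<open>F\<^sub>n\<close> only the zero orbit is bounded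
  (\<open>flow_bounded_imp_zero\<close>).
\<close>

section \<open>The closed graph theorem and contractions of bounded functions\<close>

text \<open>
  By Baire, one of the sets \<open>closure {x. \<parallel>L x\<parallel> \<le> k}\<close> contains a ball. After centring and scaling,
  every \<open>x\<close> is approximated within \<open>\<parallel>x\<parallel>/2\<close> by some \<open>y\<close> with \<open>\<parallel>L y\<parallel> \<le> c \<parallel>x\<parallel>\<close>; repeating this
  with the remainder writes \<open>x\<close> as a series whose image converges absolutely, and the closed
  graph identifies the sum of the image with \<open>L x\<close>.
\<close>

lemma closed_graph_imp_bounded_linear:
  fixes L :: "'x::banach \<Rightarrow> 'y::banach"
  assumes "linear L"
    and closed_graph: "\<And>s x y. \<lbrakk>s \<longlonglongrightarrow> x; (\<lambda>i::nat. L (s i)) \<longlonglongrightarrow> y\<rbrakk> \<Longrightarrow> L x = y"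
  shows "bounded_linear L"
proof -
  interpret L: linear L by fact
  define V where "V = (\<lambda>k::nat. {x. norm (L x) \<le> real k})"
  have "\<exists>k. interior (closure (V k)) \<noteq> {}"
  proof (rule ccontr)
    assume "\<not> ?thesis"
    then have "Met_TC.mtopology interior_of \<Union> (range (\<lambda>k. closure (V k))) = {}"
      by (intro Met_TC.metric_Baire_category_alt) (auto simp: mcomplete_iff_complete complete_UNIV)
    moreover have "\<Union> (range (\<lambda>k. closure (V k))) = UNIV"
    proof (intro equalityI subsetI UNIV_I)
      fix x
      have "x \<in> V (nat \<lceil>norm (L x)\<rceil>)" by (simp add: V_def)
      then show "x \<in> \<Union> (range (\<lambda>k. closure (V k)))" using closure_subset by blast
    qed
    ultimately show False by simp
  qed
  then obtain k a where "a \<in> interior (closure (V k))" by blast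
  then obtain r where r: "r > 0" "ball a r \<subseteq> closure (V k)"
    by (meson mem_interior)
  have small: "\<exists>y. norm (x - y) < e \<and> norm (L y) \<le> 2 * real k"
    if "norm x < r" "e > 0" for x e
  proof -
    have "a + x \<in> closure (V k)" "a \<in> closure (V k)"
      using r that by (auto simp: dist_norm subset_iff)
    then obtain u v where u: "u \<in> V k" "dist u (a + x) < e / 2" and v: "v \<in> V k" "dist v a < e / 2"
      using \<open>e > 0\<close> by (meson closure_approachable half_gt_zero)
    have "norm (x - (u - v)) = norm ((v - a) - (u - (a + x)))" by (simp add: algebra_simps)
    also have "\<dots> < e"
      using norm_triangle_ineq4[of "v - a" "u - (a + x)"] u v by (simp add: dist_norm)
    finally have "norm (x - (u - v)) < e" .
    moreover have "norm (L (u - v)) \<le> 2 * real k"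
      using norm_triangle_ineq4[of "L u" "L v"] u v by (simp add: V_def L.diff)
    ultimately show ?thesis by blast
  qed
  define c where "c = 4 * real k / r"
  have "c \<ge> 0" using r by (simp add: c_def)
  have "\<exists>y. norm (x - y) \<le> norm x / 2 \<and> norm (L y) \<le> c * norm x" for x
  proof (cases "x = 0")
    case True
    then show ?thesis by (intro exI[of _ 0]) (simp add: L.zero)
  next
    case False
    \<comment> \<open>twice the critical scale, so that \<open>x / t\<close> lies strictly inside the ball of radius \<open>r\<close>\<close>
    define t where "t = 2 * norm x / r"
    have t: "t > 0" using False r by (simp add: t_def)
    have "norm (x /\<^sub>R t) < r" using False r by (simp add: t_def field_simps)
    from small[OF this, of "norm x / (2 * t)"] False t obtain y
      where y: "norm (x /\<^sub>R t - y) < norm x / (2 * t)" "norm (L y) \<le> 2 * real k" by auto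
    have "norm (x - t *\<^sub>R y) = t * norm (x /\<^sub>R t - y)"
    proof -
      have "x - t *\<^sub>R y = t *\<^sub>R (x /\<^sub>R t - y)" using t by (simp add: scaleR_diff_right)
      then show ?thesis using t by simp
    qed
    also have "\<dots> \<le> norm x / 2" using y(1) t by (simp add: field_simps)
    finally have "norm (x - t *\<^sub>R y) \<le> norm x / 2" .
    moreover have "norm (L (t *\<^sub>R y)) \<le> c * norm x"
    proof -
      have "norm (L (t *\<^sub>R y)) = t * norm (L y)" using t by (simp add: L.scaleR)
      also have "\<dots> \<le> t * (2 * real k)" using y(2) t by simp
      also have "\<dots> = c * norm x" by (simp add: c_def t_def)
      finally show ?thesis .
    qed
    ultimately show ?thesis by blast
  qed
  then obtain g where g: "\<And>x. norm (x - g x) \<le> norm x / 2" "\<And>x. norm (L (g x)) \<le> c * norm x"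
    by metis
  have "norm (L x) \<le> norm x * (2 * c)" for x
  proof -
    define z where "z = (\<lambda>i. ((\<lambda>u. u - g u) ^^ i) x)"
    have z0: "z 0 = x" and zS: "z (Suc i) = z i - g (z i)" for i by (simp_all add: z_def)
    have nz: "norm (z i) \<le> norm x * (1/2) ^ i" for i
    proof (induction i)
      case (Suc i)
      then show ?case using g(1)[of "z i"] by (simp add: zS)
    qed (simp add: z0)
    have geo: "(\<lambda>i. c * (norm x * (1/2) ^ i)) sums (norm x * (2 * c))"
      using sums_mult[OF geometric_sums[of "1/2 :: real"], of "c * norm x"] by (simp add: ac_simps)
    have bnd: "norm (L (g (z i))) \<le> c * (norm x * (1/2) ^ i)" for i
      using g(2)[of "z i"] mult_left_mono[OF nz[of i] \<open>c \<ge> 0\<close>] by linarith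
    have sm: "summable (\<lambda>i. norm (L (g (z i))))"
      by (rule summable_comparison_test'[OF sums_summable[OF geo], of 0]) (use bnd in simp)
    have part: "(\<Sum>i<n. g (z i)) = x - z n" for n
      by (induction n) (simp_all add: z0 zS)
    have geo0: "(\<lambda>n. norm x * (1/2) ^ n) \<longlonglongrightarrow> 0"
      by (intro tendsto_mult_right_zero LIMSEQ_power_zero) simp
    have "z \<longlonglongrightarrow> 0"
      by (rule Lim_null_comparison[OF always_eventually geo0]) (use nz in blast)
    then have "(\<lambda>n. x - z n) \<longlonglongrightarrow> x - 0" by (intro tendsto_intros)
    then have "(\<lambda>n. \<Sum>i<n. g (z i)) \<longlonglongrightarrow> x" by (simp add: part)
    moreover have "(\<lambda>n. L (\<Sum>i<n. g (z i))) \<longlonglongrightarrow> (\<Sum>i. L (g (z i)))"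
      using summable_LIMSEQ[OF summable_norm_cancel[OF sm]] by (simp add: L.sum)
    ultimately have "L x = (\<Sum>i. L (g (z i)))" by (rule closed_graph)
    also have "norm \<dots> \<le> (\<Sum>i. norm (L (g (z i))))" by (rule summable_norm[OF sm])
    also have "\<dots> \<le> norm x * (2 * c)"
      using suminf_le[OF bnd sm sums_summable[OF geo]] sums_unique[OF geo] by simp
    finally show ?thesis .
  qed
  then show ?thesis using L.add L.scaleR by (intro bounded_linear_intro[where K="2 * c"])
qed

lemma continuous_on_discrete_prod:
  fixes g :: "'n::discrete_topology \<times> 'x::topological_space \<Rightarrow> 'y::topological_space"
  assumes "\<And>n. continuous_on UNIV (\<lambda>x. g (n, x))"
  shows "continuous_on UNIV g"
proof -
  have "\<exists>S. open S \<and> p \<in> S \<and> (\<forall>q\<in>UNIV. q \<in> S \<longrightarrow> g q \<in> B)" if B: "open B" "g p \<in> B" for p B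
  proof -
    obtain n x where p: "p = (n, x)" by (cases p)
    obtain S where "open S" "x \<in> S" "\<forall>y\<in>S. g (n, y) \<in> B"
      using assms[of n] B unfolding continuous_on_topological p by (metis UNIV_I)
    then show ?thesis
      by (intro exI[of _ "{n} \<times> S"]) (auto simp: p intro: open_Times open_discrete)
  qed
  then show ?thesis unfolding continuous_on_topological by simp
qed

text \<open>
  A form of Banach's theorem for functions on an arbitrary topological space: the
  contraction is measured by uniform bounds, so that no metric on the domain and no type of bounded
  functions is involved. The Picard iterates from \<open>0\<close> converge uniformly by the Weierstrass test.
\<close>

lemma uniform_contraction_fixpoint:
  fixes T :: "('x::topological_space \<Rightarrow> 'y::banach) \<Rightarrow> 'x \<Rightarrow> 'y"
  assumes c: "0 \<le> c" "c < 1"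
    and continuous: "\<And>\<zeta>. continuous_on UNIV \<zeta> \<Longrightarrow> continuous_on UNIV (T \<zeta>)"
    and bounded: "\<And>\<zeta> x. norm (T \<zeta> x) \<le> b"
    and contraction: "\<And>\<zeta> \<xi> d x. (\<And>y. norm (\<zeta> y - \<xi> y) \<le> d) \<Longrightarrow> norm (T \<zeta> x - T \<xi> x) \<le> c * d"
  obtains \<eta> where "continuous_on UNIV \<eta>" and "\<And>x. norm (\<eta> x) \<le> b" and "\<And>x. \<eta> x = T \<eta> x"
proof -
  define z where "z = (\<lambda>i. (T ^^ i) (\<lambda>_. 0))"
  have z0: "z 0 = (\<lambda>_. 0)" and zS: "z (Suc i) = T (z i)" for i by (simp_all add: z_def)
  define \<eta> where "\<eta> = (\<lambda>x. \<Sum>i. z (Suc i) x - z i x)"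
  have step: "norm (z (Suc i) x - z i x) \<le> c ^ i * b" for i x
  proof (induction i arbitrary: x)
    case 0
    show ?case using bounded[of "z 0" x] unfolding zS by (simp add: z0)
  next
    case (Suc i)
    show ?case using contraction[of "z (Suc i)" "z i", OF Suc.IH] by (simp add: zS ac_simps)
  qed
  have "uniform_limit UNIV (\<lambda>n x. \<Sum>i<n. z (Suc i) x - z i x) \<eta> sequentially"
    unfolding \<eta>_def
    by (rule Weierstrass_m_test[OF step summable_mult2[OF summable_geometric]]) (use c in simp)
  then have lim: "uniform_limit UNIV z \<eta> sequentially"
    by (simp add: sum_lessThan_telescope[of "\<lambda>i. z i _"] z0)
  have "continuous_on UNIV (z n)" for n
    by (induction n) (simp_all add: z0 zS continuous)
  then have cont: "continuous_on UNIV \<eta>"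
    by (intro uniform_limit_theorem[OF _ lim] always_eventually) simp_all
  have fixpoint: "\<eta> x = T \<eta> x" for x
  proof (rule LIMSEQ_unique)
    show "(\<lambda>n. z (Suc n) x) \<longlonglongrightarrow> \<eta> x"
      by (rule LIMSEQ_Suc[OF tendsto_uniform_limitI[OF lim]]) simp
    show "(\<lambda>n. z (Suc n) x) \<longlonglongrightarrow> T \<eta> x"
    proof (rule LIMSEQ_I)
      fix e :: real assume "e > 0"
      then have "\<forall>\<^sub>F n in sequentially. \<forall>y\<in>UNIV. dist (z n y) (\<eta> y) < e"
        by (rule uniform_limitD[OF lim])
      then obtain N where N: "norm (z n y - \<eta> y) < e" if "n \<ge> N" for n y
        unfolding eventually_sequentially by (metis UNIV_I dist_norm)
      have "norm (z (Suc n) x - T \<eta> x) < e" if "n \<ge> N" for n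
      proof -
        have "norm (z (Suc n) x - T \<eta> x) \<le> c * e"
          unfolding zS using N[OF that] by (intro contraction) (rule less_imp_le)
        also have "\<dots> < e" using c \<open>e > 0\<close> by simp
        finally show ?thesis .
      qed
      then show "\<exists>N. \<forall>n\<ge>N. norm (z (Suc n) x - T \<eta> x) < e" by blast
    qed
  qed
  have "norm (\<eta> x) \<le> b" for x using bounded[of \<eta> x] fixpoint[of x] by simp
  then show thesis using that cont fixpoint by blast
qed

section \<open>The recursion on the phase space\<close>

context phase_space
begin

text \<open>
  The segment at time \<open>1\<close> sees no index above \<open>1\<close>, so the meaningless values of \<open>ev \<phi>\<close> at larger
  integers may stay as they are.
\<close>

definition push :: "'b \<Rightarrow> 'a \<Rightarrow> 'b" where
  "push \<phi> v = seg ev ((\<lambda>i. ev \<phi> i)(1 := v)) 1"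

abbreviation kick :: "'a \<Rightarrow> 'b" where
  "kick v \<equiv> push 0 v"

lemma ev_add: "j \<le> 0 \<Longrightarrow> ev (\<phi> + \<psi>) j = ev \<phi> j + ev \<psi> j"
  using ev_linear[of j] linear_add by blast

lemma ev_scaleR: "j \<le> 0 \<Longrightarrow> ev (c *\<^sub>R \<phi>) j = c *\<^sub>R ev \<phi> j"
  using ev_linear[of j] linear_scale by blast

lemma ev_zero: "j \<le> 0 \<Longrightarrow> ev 0 j = 0"
  using ev_linear[of j] linear_0 by blast

lemma segment_of_seg: "in_phase ev x m \<Longrightarrow> segment_of ev x m (seg ev x m)"
  using seg_eqI by (auto simp: in_phase_def)

lemma in_phase_push: "in_phase ev ((\<lambda>i. ev \<phi> i)(1 := v)) 0"
  by (auto simp: in_phase_def segment_of_def intro!: exI[of _ \<phi>])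

text \<open>
  Together with injectivity of \<open>ev\<close>, this reduces identities between segments to
  pointwise identities.
\<close>

lemma ev_push:
  assumes "j \<le> 0"
  shows "ev (push \<phi> v) j = (if j = 0 then v else ev \<phi> (j + 1))"
  using segment_of_seg[OF in_phase_later[OF in_phase_push[of \<phi> v], of 1]] assms
  by (auto simp: segment_of_def push_def add.commute)

lemma push_linear_combination: "push (\<phi> + c *\<^sub>R \<psi>) (v + c *\<^sub>R w) = push \<phi> v + c *\<^sub>R push \<psi> w"
  by (rule ev_inject) (simp add: ev_push ev_add ev_scaleR)

lemma push_add: "push \<phi> (v + w) = push \<phi> v + kick w"
  using push_linear_combination[of \<phi> 1 0 v w] by simp

lemma kick_diff: "kick v - kick w = kick (v - w)"
  using push_add[of 0 w "v - w"] by simp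

lemma kick_zero: "kick 0 = 0"
  using kick_diff[of 0 0] by simp

text \<open>
  The upper bound of assumption (A) at time \<open>1\<close>, for the sequence that vanishes up to time \<open>0\<close>
  and takes the value \<open>v\<close> at time \<open>1\<close>.
\<close>

lemma norm_kick: "norm (kick v) \<le> K 1 * norm v"
proof -
  let ?x = "(\<lambda>i. ev 0 i)(1 := v)"
  have seg0: "seg ev ?x 0 = 0" by (rule seg_eqI) (auto simp: segment_of_def)
  have "{0..1} = {0, 1::int}" by auto
  then have "(SUP j\<in>{0..int 1}. norm (?x j)) = norm v"
    by (simp add: ev_zero cSup_eq_Max)
  then show ?thesis
    using norm_seg_upper[OF in_phase_push[of 0 v], of 1] by (simp add: seg0 push_def)
qed

lemma solves_solution: "solves ev g n \<phi> (solution ev g n \<phi>)"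
  unfolding solution_def by (rule theI'[OF ex1_solution])

lemma sol_op_same: "sol_op ev g n n \<phi> = \<phi>"
  using solves_solution[of g n \<phi>] by (simp add: sol_op_def solves_def seg_eqI)

lemma segment_of_solution:
  assumes "n \<le> m"
  shows "segment_of ev (solution ev g n \<phi>) (int m) (sol_op ev g m n \<phi>)"
proof -
  have "in_phase ev (solution ev g n \<phi>) (int n)"
    using solves_solution[of g n \<phi>] by (auto simp: in_phase_def solves_def)
  from in_phase_later[OF this, of "m - n"] show ?thesis
    using assms segment_of_seg by (simp add: sol_op_def)
qed

lemma sol_op_Suc:
  assumes "n \<le> m"
  shows "sol_op ev g (Suc m) n \<phi> = push (sol_op ev g m n \<phi>) (g m (sol_op ev g m n \<phi>))"
proof (rule ev_inject)
  fix j :: int assume j: "j \<le> 0"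
  let ?x = "solution ev g n \<phi>"
  have m: "segment_of ev ?x (int m) (sol_op ev g m n \<phi>)"
    and Sm: "segment_of ev ?x (int (Suc m)) (sol_op ev g (Suc m) n \<phi>)"
    using segment_of_solution[of n m] segment_of_solution[of n "Suc m"] assms by simp_all
  have "?x (int m + 1) = g m (sol_op ev g m n \<phi>)"
    using solves_solution[of g n \<phi>] assms by (simp add: solves_def sol_op_def)
  moreover have "ev (sol_op ev g m n \<phi>) (j + 1) = ?x (int m + (j + 1))" if "j \<noteq> 0"
  proof -
    from that j have "j + 1 \<le> 0" by simp
    then show ?thesis using m by (simp add: segment_of_def)
  qed
  moreover have "ev (sol_op ev g (Suc m) n \<phi>) j = ?x (int m + 1 + j)"
    using Sm j by (simp add: segment_of_def add.commute add.left_commute)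
  ultimately show "ev (sol_op ev g (Suc m) n \<phi>) j =
      ev (push (sol_op ev g m n \<phi>) (g m (sol_op ev g m n \<phi>))) j"
    using j by (auto simp: ev_push algebra_simps)
qed

lemma sol_op_step: "sol_op ev g (Suc n) n \<phi> = push \<phi> (g n \<phi>)"
  by (simp add: sol_op_Suc sol_op_same)

lemma sol_op_compose:
  assumes "l \<le> n" "n \<le> m"
  shows "sol_op ev g m n (sol_op ev g n l \<phi>) = sol_op ev g m l \<phi>"
  using assms(2)
proof (induction m rule: dec_induct)
  case (step m)
  then show ?case using assms(1) by (simp add: sol_op_Suc)
qed (simp add: sol_op_same)

text \<open>
  Linearity passes through \<open>push\<close>, which is jointly linear in the segment and the new value.
\<close>

lemma linear_sol_op:
  assumes "\<And>m. linear (A m)" "n \<le> m"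
  shows "linear (sol_op ev A m n)"
  using assms(2)
proof (induction m rule: dec_induct)
  case base
  show ?case by (intro linearI) (simp_all add: sol_op_same)
next
  case (step m)
  interpret U: linear "sol_op ev A m n" by fact
  interpret A: linear "A m" by fact
  have comb: "sol_op ev A (Suc m) n (\<phi> + c *\<^sub>R \<psi>) =
      sol_op ev A (Suc m) n \<phi> + c *\<^sub>R sol_op ev A (Suc m) n \<psi>" for \<phi> \<psi> c
    using step(1) by (simp add: sol_op_Suc U.add U.scaleR A.add A.scaleR push_linear_combination)
  have "sol_op ev A (Suc m) n 0 = 0"
    using step(1) by (simp add: sol_op_Suc U.zero A.zero kick_zero)
  then show ?case using comb[of 0] comb[where c=1] by (intro linearI) simp_all
qed

end

section \<open>Linear dynamics under an exponential dichotomy\<close>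

locale dichotomy = phase_space ev J K M
  for ev :: "'b::banach \<Rightarrow> int \<Rightarrow> 'a::banach" and J K M +
  fixes A :: "nat \<Rightarrow> 'b \<Rightarrow> 'a" and P :: "nat \<Rightarrow> 'b \<Rightarrow> 'b" and D lam :: real
  assumes linear_A: "\<And>m. linear (A m)"
    and exp_dichotomy: "uniform_exp_dichotomy ev A P D lam"
begin

abbreviation U :: "nat \<Rightarrow> nat \<Rightarrow> 'b \<Rightarrow> 'b" where
  "U \<equiv> sol_op ev A"

abbreviation Q :: "nat \<Rightarrow> 'b \<Rightarrow> 'b" where
  "Q \<equiv> Qproj P"

text \<open>
  Following linear orbits inside \<open>ker P\<close>, in both time directions. Composing with \<open>Q n\<close> makes it a
  total linear operator, so that the functions \<open>\<eta>\<close> can be defined on the whole phase space and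
  restricted to \<open>F\<^sub>n\<close> only at the end.
\<close>

definition flow :: "nat \<Rightarrow> nat \<Rightarrow> 'b \<Rightarrow> 'b" where
  "flow m n \<phi> = evol ev A P m n (Q n \<phi>)"

lemma linear_U: "n \<le> m \<Longrightarrow> linear (U m n)"
  by (rule linear_sol_op[OF linear_A])

lemma D_pos: "D > 0" and lam_pos: "lam > 0"
  and linear_P: "linear (P n)"
  and P_idem: "P n (P n \<phi>) = P n \<phi>"
  using exp_dichotomy by (auto simp: uniform_exp_dichotomy_def fun_eq_iff)

lemma bij_U: "n \<le> m \<Longrightarrow> bij_betw (U m n) (kerP P n) (kerP P m)"
  using exp_dichotomy by (simp add: uniform_exp_dichotomy_def)

lemma inj_U: "n \<le> m \<Longrightarrow> U m n \<phi> = U m n \<psi> \<Longrightarrow> \<phi> \<in> kerP P n \<Longrightarrow> \<psi> \<in> kerP P n \<Longrightarrow> \<phi> = \<psi>"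
  using bij_U[of n m] by (auto simp: bij_betw_def dest: inj_onD)

lemma U_in_kerP: "n \<le> m \<Longrightarrow> \<phi> \<in> kerP P n \<Longrightarrow> U m n \<phi> \<in> kerP P m"
  using bij_U bij_betwE by blast

lemma Q_in_kerP: "Q n \<phi> \<in> kerP P n"
  by (simp add: Qproj_def kerP_def linear_diff[OF linear_P] P_idem)

lemma Q_id: "\<phi> \<in> kerP P n \<Longrightarrow> Q n \<phi> = \<phi>"
  by (simp add: Qproj_def kerP_def)

lemma Fsp_eq_kerP: "Fsp P n = kerP P n"
proof
  show "Fsp P n \<subseteq> kerP P n" by (auto simp: Fsp_def Q_in_kerP)
  show "kerP P n \<subseteq> Fsp P n"
  proof
    fix \<phi> assume "\<phi> \<in> kerP P n"
    then have "\<phi> = Q n \<phi>" by (simp add: Q_id)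
    then show "\<phi> \<in> Fsp P n" unfolding Fsp_def by (rule range_eqI)
  qed
qed

lemma bounded_linear_UP:
  assumes "n \<le> m"
  shows "bounded_linear (\<lambda>\<phi>. U m n (P n \<phi>))"
    and "onorm (\<lambda>\<phi>. U m n (P n \<phi>)) \<le> D * exp (- lam * (real m - real n))"
proof -
  have "bounded_linear (evol ev A P m n \<circ> P n) \<and>
      onorm (evol ev A P m n \<circ> P n) \<le> D * exp (- lam * (real m - real n))"
    using exp_dichotomy assms unfolding uniform_exp_dichotomy_def by blast
  then show "bounded_linear (\<lambda>\<phi>. U m n (P n \<phi>))"
    and "onorm (\<lambda>\<phi>. U m n (P n \<phi>)) \<le> D * exp (- lam * (real m - real n))"
    using assms by (simp_all add: comp_def evol_def)
qed

lemma bounded_linear_P: "bounded_linear (P n)"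
  using bounded_linear_UP(1)[of n n] by (simp add: sol_op_same)

lemma bounded_linear_Q: "bounded_linear (Q n)"
  unfolding Qproj_def by (intro bounded_linear_sub bounded_linear_ident bounded_linear_P)

lemma flow_forward: "n \<le> m \<Longrightarrow> flow m n \<phi> = U m n (Q n \<phi>)"
  by (simp add: flow_def evol_def)

lemma bounded_linear_flow_backward:
  assumes "m < n"
  shows "bounded_linear (flow m n)"
    and "onorm (flow m n) \<le> D * exp (- lam * (real n - real m))"
  using exp_dichotomy assms by (simp_all add: uniform_exp_dichotomy_def comp_def flow_def[abs_def])

lemma flow_in_kerP: "flow m n \<phi> \<in> kerP P m"
proof (cases "n \<le> m")
  case True
  then show ?thesis by (simp add: flow_forward U_in_kerP Q_in_kerP)
next
  case False
  then have "U n m ` kerP P m = kerP P n"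
    using bij_U by (simp add: bij_betw_def)
  then show ?thesis
    using False inv_into_into[of "Q n \<phi>" "U n m" "kerP P m"] Q_in_kerP
    by (simp add: flow_def evol_def)
qed

lemma U_flow_inverse: "m < n \<Longrightarrow> U n m (flow m n \<phi>) = Q n \<phi>"
  using bij_U[of m n] Q_in_kerP[of n \<phi>]
  by (simp add: flow_def evol_def bij_betw_def f_inv_into_f)

text \<open>
  When the target time \<open>k\<close> lies before the base time \<open>m\<close>, both sides are compared after applying
  \<open>U m k\<close>, which is injective on \<open>ker P\<^sub>k\<close>.
\<close>

lemma U_flow:
  assumes "n \<le> k"
  shows "U k n (flow n m \<phi>) = flow k m \<phi>"
proof -
  consider "m \<le> n" | "n < m" "m \<le> k" | "k < m" by linarith
  then show ?thesis
  proof cases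
    case 1
    then show ?thesis using assms by (simp add: flow_forward sol_op_compose)
  next
    case 2
    then have "U k n (flow n m \<phi>) = U k m (U m n (flow n m \<phi>))"
      by (simp add: sol_op_compose)
    then show ?thesis using 2 by (simp add: U_flow_inverse flow_forward)
  next
    case 3
    have "U m k (U k n (flow n m \<phi>)) = U m k (flow k m \<phi>)"
      using 3 assms by (simp add: sol_op_compose U_flow_inverse)
    then show ?thesis
      by (rule inj_U[rotated]) (use 3 assms in \<open>simp_all add: U_in_kerP flow_in_kerP\<close>)
  qed
qed

lemma flow_same: "\<phi> \<in> kerP P n \<Longrightarrow> flow n n \<phi> = \<phi>"
  by (simp add: flow_forward sol_op_same Q_id)

lemma flow_U:
  assumes "n \<le> m" "\<phi> \<in> kerP P n"
  shows "flow k m (U m n \<phi>) = flow k n \<phi>"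
proof (cases "m \<le> k")
  case True
  then show ?thesis using assms by (simp add: flow_forward Q_id U_in_kerP sol_op_compose)
next
  case False
  have "U m k (flow k m (U m n \<phi>)) = U m k (flow k n \<phi>)"
    using False assms by (simp add: U_flow flow_same U_in_kerP flow_forward Q_id)
  then show ?thesis by (rule inj_U[rotated]) (use False in \<open>simp_all add: flow_in_kerP\<close>)
qed

text \<open>
  The one place where completeness of the phase space enters through Baire. The graph is closed
  because \<open>ker P\<^bsub>n+1\<^esub>\<close> is closed and the backward flow, a left inverse of \<open>U(n+1,n)\<close> on \<open>ker P\<^sub>n\<close>, is
  continuous by the dichotomy estimate.
\<close>

lemma bounded_linear_UQ_step: "bounded_linear (\<lambda>\<phi>. U (Suc n) n (Q n \<phi>))"
proof (rule closed_graph_imp_bounded_linear)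
  show "linear (\<lambda>\<phi>. U (Suc n) n (Q n \<phi>))"
    using linear_compose[OF bounded_linear.linear[OF bounded_linear_Q[of n]] linear_U[of n "Suc n"]]
    by (simp add: comp_def)
next
  fix s :: "nat \<Rightarrow> 'b" and \<phi> \<psi>
  assume s: "s \<longlonglongrightarrow> \<phi>" and Us: "(\<lambda>i. U (Suc n) n (Q n (s i))) \<longlonglongrightarrow> \<psi>"
  let ?S = "flow n (Suc n)"
  have S: "bounded_linear ?S" by (rule bounded_linear_flow_backward) simp
  have "(\<lambda>i. P (Suc n) (U (Suc n) n (Q n (s i)))) \<longlonglongrightarrow> P (Suc n) \<psi>"
    by (rule bounded_linear.tendsto[OF bounded_linear_P Us])
  moreover have "P (Suc n) (U (Suc n) n (Q n (s i))) = 0" for i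
    using U_in_kerP[OF _ Q_in_kerP, of n "Suc n"] by (simp add: kerP_def)
  ultimately have "P (Suc n) \<psi> = 0" using LIMSEQ_unique[OF _ tendsto_const] by simp
  then have \<psi>: "Q (Suc n) \<psi> = \<psi>" by (simp add: Qproj_def)
  have "?S (U (Suc n) n (Q n \<theta>)) = Q n \<theta>" for \<theta>
    by (simp add: flow_U Q_in_kerP flow_forward sol_op_same Q_id)
  then have "(\<lambda>i. Q n (s i)) \<longlonglongrightarrow> ?S \<psi>"
    using bounded_linear.tendsto[OF S Us] by simp
  moreover have "(\<lambda>i. Q n (s i)) \<longlonglongrightarrow> Q n \<phi>"
    by (rule bounded_linear.tendsto[OF bounded_linear_Q s])
  ultimately have "Q n \<phi> = ?S \<psi>" by (rule LIMSEQ_unique[rotated])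
  then show "U (Suc n) n (Q n \<phi>) = \<psi>" using \<psi> by (simp add: U_flow_inverse)
qed

lemma bounded_linear_U_step: "bounded_linear (U (Suc n) n)"
proof -
  have "U (Suc n) n = (\<lambda>\<phi>. U (Suc n) n (P n \<phi>) + U (Suc n) n (Q n \<phi>))"
    by (simp add: Qproj_def linear_diff[OF linear_U] fun_eq_iff)
  then show ?thesis
    using bounded_linear_add[OF bounded_linear_UP(1) bounded_linear_UQ_step, of n "Suc n" n] by simp
qed

lemma bounded_linear_U:
  assumes "n \<le> m"
  shows "bounded_linear (U m n)"
  using assms
proof (induction m rule: dec_induct)
  case base
  have "U n n = (\<lambda>\<phi>. \<phi>)" by (simp add: fun_eq_iff sol_op_same)
  then show ?case by (simp add: bounded_linear_ident)
next
  case (step m)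
  have "U (Suc m) n = (\<lambda>\<phi>. U (Suc m) m (U m n \<phi>))"
    using step(1) by (simp add: fun_eq_iff sol_op_compose)
  then show ?case using bounded_linear_compose[OF bounded_linear_U_step step.IH] by simp
qed

lemma bounded_linear_flow: "bounded_linear (flow m n)"
proof (cases "n \<le> m")
  case True
  then have "flow m n = (\<lambda>\<phi>. U m n (Q n \<phi>))" by (simp add: fun_eq_iff flow_forward)
  then show ?thesis using bounded_linear_compose[OF bounded_linear_U[OF True] bounded_linear_Q] by simp
qed (simp add: bounded_linear_flow_backward)

section \<open>Summation against the Green operator\<close>

abbreviation G :: "nat \<Rightarrow> nat \<Rightarrow> 'b \<Rightarrow> 'b" where
  "G \<equiv> green ev A P"

lemma green_eq: "G m n = (if n \<le> m then (\<lambda>\<phi>. U m n (P n \<phi>)) else (\<lambda>\<phi>. - flow m n \<phi>))"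
  by (simp add: green_def[abs_def] evol_def flow_def fun_eq_iff)

lemma bounded_linear_green: "bounded_linear (G m n)"
  by (simp add: green_eq bounded_linear_UP bounded_linear_minus bounded_linear_flow)

lemma onorm_green: "onorm (G m n) \<le> D * exp (- lam * \<bar>real m - real n\<bar>)"
  using bounded_linear_UP(2)[of n m] bounded_linear_flow_backward(2)[of m n]
  by (auto simp: green_eq onorm_neg)

text \<open>
  The jump at \<open>k = n\<close> is \<open>P + Q = Id\<close>: the forward branch starts with \<open>P\<^bsub>n+1\<^esub>\<close> while the backward
  branch ends with \<open>-Q\<^bsub>n+1\<^esub>\<close>.
\<close>

lemma green_step: "G (Suc n) (Suc k) \<phi> = U (Suc n) n (G n (Suc k) \<phi>) + (if k = n then \<phi> else 0)"
proof -
  have neg: "U (Suc n) n (- \<psi>) = - U (Suc n) n \<psi>" for \<psi>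
    using linear_U[of n "Suc n"] by (simp add: linear_neg)
  consider "k < n" | "k = n" | "n < k" by linarith
  then show ?thesis
  proof cases
    case 1
    then show ?thesis by (simp add: green_eq sol_op_compose)
  next
    case 2
    then show ?thesis by (simp add: green_eq neg U_flow_inverse Qproj_def sol_op_same)
  next
    case 3
    then show ?thesis by (simp add: green_eq neg U_flow)
  qed
qed

definition green_bound :: real where
  "green_bound = 2 * D / (1 - exp (- lam))"

lemma green_bound_pos: "green_bound > 0"
  using D_pos lam_pos by (simp add: green_bound_def)

text \<open>
  Indices below \<open>m\<close> and from \<open>m\<close> on each contribute at most a geometric series in
  \<open>e\<^bsup>-\<lambda>\<^esup>\<close>; this is the origin of the factor \<open>2\<close> in \<open>green_bound\<close>.
\<close>

lemma sum_green_le: "(\<Sum>k<N. onorm (G m (Suc k))) \<le> green_bound"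
proof -
  define q where "q = exp (- lam)"
  have q: "0 < q" "q < 1" using lam_pos by (simp_all add: q_def)
  have pow: "exp (- lam * real i) = q ^ i" for i
    by (simp add: q_def exp_of_nat_mult[symmetric] mult.commute)
  have geo: "(\<Sum>i\<in>I. q ^ i) \<le> 1 / (1 - q)" if "finite I" for I
    using sum_le_suminf[OF summable_geometric[of q], of I] that q suminf_geometric[of q] by simp
  have left: "(\<Sum>k\<in>{..<N} \<inter> {..<m}. onorm (G m (Suc k))) \<le> D * (1 / (1 - q))"
  proof -
    have "(\<Sum>k\<in>{..<N} \<inter> {..<m}. onorm (G m (Suc k))) \<le> (\<Sum>k\<in>{..<N} \<inter> {..<m}. D * q ^ (m - Suc k))"
    proof (rule sum_mono)
      fix k assume "k \<in> {..<N} \<inter> {..<m}"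
      then have "\<bar>real m - real (Suc k)\<bar> = real (m - Suc k)" by auto
      then show "onorm (G m (Suc k)) \<le> D * q ^ (m - Suc k)"
        using onorm_green[of m "Suc k"] pow[of "m - Suc k"] by simp
    qed
    also have "\<dots> = D * (\<Sum>i\<in>(\<lambda>k. m - Suc k) ` ({..<N} \<inter> {..<m}). q ^ i)"
      by (subst sum.reindex) (auto simp: inj_on_def sum_distrib_left)
    also have "\<dots> \<le> D * (1 / (1 - q))"
      using D_pos by (intro mult_left_mono geo) auto
    finally show ?thesis .
  qed
  have right: "(\<Sum>k\<in>{..<N} - {..<m}. onorm (G m (Suc k))) \<le> D * (1 / (1 - q))"
  proof -
    have "(\<Sum>k\<in>{..<N} - {..<m}. onorm (G m (Suc k))) \<le> (\<Sum>k\<in>{..<N} - {..<m}. D * q ^ (Suc k - m))"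
    proof (rule sum_mono)
      fix k assume "k \<in> {..<N} - {..<m}"
      then have "\<bar>real m - real (Suc k)\<bar> = real (Suc k - m)" by auto
      then show "onorm (G m (Suc k)) \<le> D * q ^ (Suc k - m)"
        using onorm_green[of m "Suc k"] pow[of "Suc k - m"] by simp
    qed
    also have "\<dots> = D * (\<Sum>i\<in>(\<lambda>k. Suc k - m) ` ({..<N} - {..<m}). q ^ i)"
      by (subst sum.reindex) (auto simp: inj_on_def sum_distrib_left)
    also have "\<dots> \<le> D * (1 / (1 - q))"
      using D_pos by (intro mult_left_mono geo) auto
    finally show ?thesis .
  qed
  have "(\<Sum>k<N. onorm (G m (Suc k))) =
      (\<Sum>k\<in>{..<N} \<inter> {..<m}. onorm (G m (Suc k))) + (\<Sum>k\<in>{..<N} - {..<m}. onorm (G m (Suc k)))"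
    by (rule sum.Int_Diff) simp
  also have "\<dots> \<le> D * (1 / (1 - q)) + D * (1 / (1 - q))" by (rule add_mono[OF left right])
  finally show ?thesis by (simp add: green_bound_def q_def)
qed

lemma summable_green: "summable (\<lambda>k. onorm (G m (Suc k)))"
proof (rule bounded_imp_summable)
  show "0 \<le> onorm (G m (Suc k))" for k by (rule onorm_pos_le[OF bounded_linear_green])
  show "(\<Sum>k\<le>N. onorm (G m (Suc k))) \<le> green_bound" for N
    using sum_green_le[where N="Suc N"] by (simp only: lessThan_Suc_atMost)
qed

lemma suminf_green_le: "(\<Sum>k. onorm (G m (Suc k))) \<le> green_bound"
  using suminf_le_const[OF summable_green] sum_green_le by blast

lemma norm_green_le: "norm w \<le> b \<Longrightarrow> norm (G m n w) \<le> onorm (G m n) * b"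
  using onorm[OF bounded_linear_green, of m n w]
    mult_left_mono[OF _ onorm_pos_le[OF bounded_linear_green, of m n], of "norm w" b] by linarith

lemma summable_green_apply:
  assumes "\<And>k. norm (w k) \<le> b"
  shows "summable (\<lambda>k. norm (G m (Suc k) (w k)))"
  by (rule summable_comparison_test'[OF summable_mult2[OF summable_green, where c=b], of 0])
     (use norm_green_le[OF assms] in simp)

lemma norm_suminf_green_le:
  assumes "\<And>k. norm (w k) \<le> b"
  shows "norm (\<Sum>k. G m (Suc k) (w k)) \<le> green_bound * b"
proof -
  have "b \<ge> 0" using assms[of 0] norm_ge_zero order_trans by blast
  have "norm (\<Sum>k. G m (Suc k) (w k)) \<le> (\<Sum>k. norm (G m (Suc k) (w k)))"
    by (rule summable_norm[OF summable_green_apply[OF assms]])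
  also have "\<dots> \<le> (\<Sum>k. onorm (G m (Suc k)) * b)"
    by (intro suminf_le summable_green_apply[OF assms] summable_mult2 summable_green norm_green_le assms)
  also have "\<dots> = (\<Sum>k. onorm (G m (Suc k))) * b"
    by (rule suminf_mult2[OF summable_green, symmetric])
  also have "\<dots> \<le> green_bound * b"
    by (rule mult_right_mono[OF suminf_green_le \<open>b \<ge> 0\<close>])
  finally show ?thesis .
qed

text \<open>
  The one-step evolution may be taken inside the series because it is bounded.
\<close>

lemma suminf_green_step:
  assumes "\<And>k. norm (w k) \<le> b"
  shows "(\<Sum>k. G (Suc n) (Suc k) (w k)) = U (Suc n) n (\<Sum>k. G n (Suc k) (w k)) + w n"
proof -
  have sums: "(\<lambda>k. G n (Suc k) (w k)) sums (\<Sum>k. G n (Suc k) (w k))"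
    by (rule summable_sums[OF summable_norm_cancel[OF summable_green_apply[OF assms]]])
  have single: "(\<lambda>k. if k = n then w k else 0) sums w n"
    using sums_single[of n w] by simp
  show ?thesis
    using sums_add[OF bounded_linear.sums[OF bounded_linear_U_step sums] single]
    by (simp add: green_step sums_iff)
qed

text \<open>
  On \<open>ker P\<^sub>n\<close> every vector is recovered from its future by the backward flow, which contracts at
  rate \<open>e\<^bsup>-\<lambda>\<^esup>\<close>; a bounded future therefore forces the vector to vanish.
\<close>

lemma flow_bounded_imp_zero:
  assumes "\<phi> \<in> kerP P n" and "\<And>m. m \<ge> n \<Longrightarrow> norm (U m n \<phi>) \<le> b"
  shows "\<phi> = 0"
proof -
  have bound: "norm \<phi> \<le> (D * b) * exp (- lam) ^ Suc i" for i
  proof -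
    let ?m = "n + Suc i"
    have "\<phi> = flow n ?m (U ?m n \<phi>)" using assms(1) by (simp add: flow_U flow_same)
    then have "norm \<phi> \<le> onorm (flow n ?m) * norm (U ?m n \<phi>)"
      using onorm[OF bounded_linear_flow, of n ?m "U ?m n \<phi>"] by simp
    also have "\<dots> \<le> (D * exp (- lam * (real ?m - real n))) * b"
      by (rule mult_mono[OF bounded_linear_flow_backward(2) assms(2)]) (use D_pos in simp_all)
    also have "exp (- lam * (real ?m - real n)) = exp (- lam) ^ Suc i"
      by (simp only: exp_of_nat_mult[symmetric]) (simp add: algebra_simps)
    finally show ?thesis by (simp only: ac_simps)
  qed
  have "(\<lambda>i. (D * b) * exp (- lam) ^ Suc i) \<longlonglongrightarrow> 0"
    by (rule tendsto_mult_right_zero[OF LIMSEQ_Suc[OF LIMSEQ_power_zero]]) (use lam_pos in simp)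
  then have "norm \<phi> \<le> 0" by (rule LIMSEQ_le_const) (use bound in blast)
  then show ?thesis by simp
qed

end

section \<open>The semilinear equation\<close>

locale semilinear_perturbation = dichotomy ev J K M A P D lam
  for ev :: "'b::banach \<Rightarrow> int \<Rightarrow> 'a::banach" and J K M A P D lam +
  fixes f :: "nat \<Rightarrow> 'b \<Rightarrow> 'a" and C :: real
  assumes f_zero: "f m 0 = 0"
    and f_diff: "norm (f m \<phi> - f m \<psi>) \<le> C * min 1 (norm (\<phi> - \<psi>))"
    and C_pos: "C > 0"
    and small: "K 1 * (C * green_bound) < 1"
begin

abbreviation R :: "nat \<Rightarrow> nat \<Rightarrow> 'b \<Rightarrow> 'b" where
  "R \<equiv> sol_op ev (\<lambda>m \<phi>. A m \<phi> + f m \<phi>)"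

text \<open>
  The nonlinear input along the linear orbit through \<open>\<phi>\<close> at time \<open>n\<close>, corrected by \<open>\<zeta>\<close>. It depends
  on the orbit only, which is what makes the conjugacy work.
\<close>

definition forcing :: "(nat \<times> 'b \<Rightarrow> 'b) \<Rightarrow> nat \<Rightarrow> 'b \<Rightarrow> nat \<Rightarrow> 'b" where
  "forcing \<zeta> n \<phi> k = kick (f k (flow k n \<phi> + \<zeta> (k, flow k n \<phi>)))"

definition lyapunov_perron :: "(nat \<times> 'b \<Rightarrow> 'b) \<Rightarrow> nat \<times> 'b \<Rightarrow> 'b" where
  "lyapunov_perron \<zeta> = (\<lambda>(n, \<phi>). \<Sum>k. G n (Suc k) (forcing \<zeta> n \<phi> k))"

lemma norm_f_le: "norm (f m \<phi>) \<le> C"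
proof -
  have "norm (f m \<phi>) \<le> C * min 1 (norm \<phi>)" using f_diff[of m \<phi> 0] by (simp add: f_zero)
  also have "\<dots> \<le> C * 1" using C_pos by (intro mult_left_mono) auto
  finally show ?thesis by simp
qed

lemma norm_f_diff_le: "norm (f m \<phi> - f m \<psi>) \<le> C * norm (\<phi> - \<psi>)"
proof -
  have "C * min 1 (norm (\<phi> - \<psi>)) \<le> C * norm (\<phi> - \<psi>)" using C_pos by (intro mult_left_mono) auto
  then show ?thesis using f_diff[of m \<phi> \<psi>] by linarith
qed

lemma norm_forcing: "norm (forcing \<zeta> n \<phi> k) \<le> K 1 * C"
  using norm_kick mult_left_mono[OF norm_f_le K_nonneg[of 1]] order_trans
  unfolding forcing_def by blast

lemma norm_forcing_diff:
  assumes "\<And>p. norm (\<zeta> p - \<xi> p) \<le> d"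
  shows "norm (forcing \<zeta> n \<phi> k - forcing \<xi> n \<phi> k) \<le> K 1 * (C * d)"
proof -
  let ?p = "(k, flow k n \<phi>)"
  let ?d = "f k (flow k n \<phi> + \<zeta> ?p) - f k (flow k n \<phi> + \<xi> ?p)"
  have "norm ?d \<le> C * norm (\<zeta> ?p - \<xi> ?p)"
    using norm_f_diff_le[of k "flow k n \<phi> + \<zeta> ?p" "flow k n \<phi> + \<xi> ?p"] by simp
  also have "\<dots> \<le> C * d"
    using assms C_pos by (intro mult_left_mono) auto
  finally have "K 1 * norm ?d \<le> K 1 * (C * d)"
    by (rule mult_left_mono[OF _ K_nonneg])
  then show ?thesis using norm_kick[of ?d] by (simp add: forcing_def kick_diff)
qed

lemma continuous_forcing:
  assumes "continuous_on UNIV \<zeta>"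
  shows "continuous_on UNIV (\<lambda>\<phi>. forcing \<zeta> n \<phi> k)"
proof -
  have "C-lipschitz_on UNIV (f k)"
    by (rule lipschitz_onI) (use C_pos norm_f_diff_le in \<open>simp_all add: dist_norm\<close>)
  then have f: "continuous_on UNIV (f k)" by (rule lipschitz_on_continuous_on)
  have "(K 1)-lipschitz_on UNIV kick"
    by (rule lipschitz_onI) (use K_nonneg norm_kick in \<open>simp_all add: dist_norm kick_diff\<close>)
  then have kick: "continuous_on UNIV kick" by (rule lipschitz_on_continuous_on)
  have flow: "continuous_on UNIV (flow k n)"
    by (simp add: linear_continuous_on bounded_linear_flow)
  show ?thesis
    unfolding forcing_def
    by (intro continuous_on_compose2[OF kick] continuous_on_compose2[OF f]
        continuous_on_compose2[OF assms] continuous_intros flow) auto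
qed

text \<open>
  Continuity in \<open>\<phi>\<close> rests on continuity of \<open>flow k n\<close> also for \<open>k > n\<close>, that is, on the
  closed graph theorem.
\<close>

lemma continuous_lyapunov_perron:
  assumes "continuous_on UNIV \<zeta>"
  shows "continuous_on UNIV (lyapunov_perron \<zeta>)"
proof (rule continuous_on_discrete_prod)
  fix n
  have lim: "uniform_limit UNIV (\<lambda>N \<phi>. \<Sum>k<N. G n (Suc k) (forcing \<zeta> n \<phi> k))
      (\<lambda>\<phi>. \<Sum>k. G n (Suc k) (forcing \<zeta> n \<phi> k)) sequentially"
    by (rule Weierstrass_m_test[OF norm_green_le[OF norm_forcing] summable_mult2[OF summable_green]])
  have "continuous_on UNIV (\<lambda>\<phi>. \<Sum>k<N. G n (Suc k) (forcing \<zeta> n \<phi> k))" for N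
    by (intro continuous_on_sum continuous_forcing assms
        bounded_linear.continuous_on[OF bounded_linear_green])
  then show "continuous_on UNIV (\<lambda>\<phi>. lyapunov_perron \<zeta> (n, \<phi>))"
    unfolding lyapunov_perron_def prod.case
    by (intro uniform_limit_theorem[OF _ lim] always_eventually) simp_all
qed

lemma norm_lyapunov_perron: "norm (lyapunov_perron \<zeta> p) \<le> green_bound * (K 1 * C)"
  unfolding lyapunov_perron_def case_prod_beta
  by (rule norm_suminf_green_le) (rule norm_forcing)

lemma lyapunov_perron_contraction:
  assumes "\<And>p. norm (\<zeta> p - \<xi> p) \<le> d"
  shows "norm (lyapunov_perron \<zeta> p - lyapunov_perron \<xi> p) \<le> (K 1 * (C * green_bound)) * d"
proof (cases p)
  case (Pair n \<phi>)
  have sm: "summable (\<lambda>k. G n (Suc k) (forcing \<theta> n \<phi> k))" for \<theta>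
    by (rule summable_norm_cancel[OF summable_green_apply])  (rule norm_forcing)
  have "lyapunov_perron \<zeta> p - lyapunov_perron \<xi> p =
      (\<Sum>k. G n (Suc k) (forcing \<zeta> n \<phi> k - forcing \<xi> n \<phi> k))"
    unfolding lyapunov_perron_def Pair prod.case suminf_diff[OF sm sm]
    by (simp add: linear_diff[OF bounded_linear.linear[OF bounded_linear_green]])
  moreover have "norm (\<Sum>k. G n (Suc k) (forcing \<zeta> n \<phi> k - forcing \<xi> n \<phi> k)) \<le>
      green_bound * (K 1 * (C * d))"
    by (rule norm_suminf_green_le, rule norm_forcing_diff, rule assms)
  ultimately show ?thesis by (simp only: ac_simps)
qed

lemma lyapunov_perron_fixpoint:
  obtains \<eta> where "continuous_on UNIV \<eta>" and "\<And>p. norm (\<eta> p) \<le> green_bound * (K 1 * C)"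
    and "\<And>p. \<eta> p = lyapunov_perron \<eta> p"
proof (rule uniform_contraction_fixpoint[where T=lyapunov_perron])
  show "0 \<le> K 1 * (C * green_bound)" using K_nonneg[of 1] C_pos green_bound_pos by simp
  show "K 1 * (C * green_bound) < 1" by (rule small)
  show "continuous_on UNIV (lyapunov_perron \<zeta>)" if "continuous_on UNIV \<zeta>" for \<zeta>
    using that by (rule continuous_lyapunov_perron)
  show "norm (lyapunov_perron \<zeta> p) \<le> green_bound * (K 1 * C)" for \<zeta> p
    by (rule norm_lyapunov_perron)
  show "norm (lyapunov_perron \<zeta> p - lyapunov_perron \<xi> p) \<le> K 1 * (C * green_bound) * d"
    if "\<And>q. norm (\<zeta> q - \<xi> q) \<le> d" for \<zeta> \<xi> d p
    using that by (rule lyapunov_perron_contraction)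
qed (rule that)

text \<open>
  Moving the base point along its linear orbit leaves the forcing unchanged, so the step identity for
  Green series applies with one and the same input at times \<open>m\<close> and \<open>m + 1\<close>.
\<close>

lemma fixpoint_conjugates:
  assumes fixpoint: "\<And>p. \<eta> p = lyapunov_perron \<eta> p" and "n \<le> m" "\<phi> \<in> kerP P n"
  shows "U m n \<phi> + \<eta> (m, U m n \<phi>) = R m n (\<phi> + \<eta> (n, \<phi>))"
  using assms(2)
proof (induction m rule: dec_induct)
  case base
  show ?case by (simp add: sol_op_same)
next
  case (step m)
  define \<psi> where "\<psi> = U m n \<phi>"
  have \<psi>: "\<psi> \<in> kerP P m" unfolding \<psi>_def by (rule U_in_kerP[OF step(1) assms(3)])
  have step_\<psi>: "U (Suc m) n \<phi> = U (Suc m) m \<psi>"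
    using step(1) by (simp add: \<psi>_def sol_op_compose)
  have "forcing \<eta> (Suc m) (U (Suc m) m \<psi>) = forcing \<eta> m \<psi>"
    unfolding forcing_def using flow_U[OF _ \<psi>, of "Suc m"] by (simp add: fun_eq_iff)
  then have "\<eta> (Suc m, U (Suc m) m \<psi>) = (\<Sum>k. G (Suc m) (Suc k) (forcing \<eta> m \<psi> k))"
    unfolding fixpoint[of "(Suc m, U (Suc m) m \<psi>)"] by (simp add: lyapunov_perron_def)
  also have "\<dots> = U (Suc m) m (\<eta> (m, \<psi>)) + forcing \<eta> m \<psi> m"
    unfolding suminf_green_step[of "forcing \<eta> m \<psi>", OF norm_forcing] fixpoint[of "(m, \<psi>)"]
    by (simp add: lyapunov_perron_def)
  finally have "U (Suc m) m \<psi> + \<eta> (Suc m, U (Suc m) m \<psi>) =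
      U (Suc m) m (\<psi> + \<eta> (m, \<psi>)) + kick (f m (\<psi> + \<eta> (m, \<psi>)))"
    by (simp add: forcing_def flow_same[OF \<psi>] linear_add[OF linear_U])
  also have "\<dots> = R (Suc m) m (\<psi> + \<eta> (m, \<psi>))"
    by (simp add: sol_op_step push_add)
  also have "\<psi> + \<eta> (m, \<psi>) = R m n (\<phi> + \<eta> (n, \<phi>))"
    using step.IH by (simp add: \<psi>_def)
  finally show ?case
    using step(1) by (simp add: step_\<psi> sol_op_compose)
qed

text \<open>
  Equal images have equal semilinear futures, hence linear futures that differ by two values of
  \<open>\<eta>\<close>.
\<close>

lemma bounded_conjugacy_inj:
  assumes conj: "\<And>m \<phi>. n \<le> m \<Longrightarrow> \<phi> \<in> kerP P n \<Longrightarrow>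
      U m n \<phi> + \<eta> (m, U m n \<phi>) = R m n (\<phi> + \<eta> (n, \<phi>))"
    and bounded: "\<And>p. norm (\<eta> p) \<le> b"
  shows "inj_on (\<lambda>\<phi>. \<phi> + \<eta> (n, \<phi>)) (kerP P n)"
proof (rule inj_onI)
  fix \<phi> \<psi>
  assume ker: "\<phi> \<in> kerP P n" "\<psi> \<in> kerP P n" and eq: "\<phi> + \<eta> (n, \<phi>) = \<psi> + \<eta> (n, \<psi>)"
  have "norm (U m n (\<phi> - \<psi>)) \<le> 2 * b" if "m \<ge> n" for m
  proof -
    have "U m n \<phi> + \<eta> (m, U m n \<phi>) = U m n \<psi> + \<eta> (m, U m n \<psi>)"
      using conj[OF that] ker eq by simp
    then have "U m n (\<phi> - \<psi>) = \<eta> (m, U m n \<psi>) - \<eta> (m, U m n \<phi>)"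
      by (simp add: linear_diff[OF linear_U[OF that]] algebra_simps)
    then show ?thesis
      using norm_triangle_ineq4[of "\<eta> (m, U m n \<psi>)" "\<eta> (m, U m n \<phi>)"]
        bounded[of "(m, U m n \<psi>)"] bounded[of "(m, U m n \<phi>)"] by simp
  qed
  moreover have "\<phi> - \<psi> \<in> kerP P n"
    using ker by (simp add: kerP_def linear_diff[OF linear_P])
  ultimately have "\<phi> - \<psi> = 0" by (intro flow_bounded_imp_zero)
  then show "\<phi> = \<psi>" by simp
qed

end

theorem mainTheorem2:
  fixes ev :: "'b::banach \<Rightarrow> int \<Rightarrow> 'a::banach"
    and J :: real and K M :: "nat \<Rightarrow> real"
    and A :: "nat \<Rightarrow> 'b \<Rightarrow> 'a"
    and P :: "nat \<Rightarrow> 'b \<Rightarrow> 'b"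
    and D lam :: real
  assumes "phase_space ev J K M"
    and "\<And>m. linear (A m)"
    and "uniform_exp_dichotomy ev A P D lam"
  shows "\<exists>C0>0. \<forall>C (f :: nat \<Rightarrow> 'b \<Rightarrow> 'a).
    0 < C \<longrightarrow> C < C0 \<longrightarrow>
    (\<forall>m. f m 0 = 0) \<longrightarrow>
    (\<forall>m \<phi> \<psi>. norm (f m \<phi> - f m \<psi>) \<le> C * min 1 (norm (\<phi> - \<psi>))) \<longrightarrow>
    ((\<forall>m. summable (\<lambda>n. C * onorm (green ev A P m (n + 1)))) \<and>
     bdd_above (range (\<lambda>m. \<Sum>n. C * onorm (green ev A P m (n + 1)))) \<and>
     K 1 * (SUP m. \<Sum>n. C * onorm (green ev A P m (n + 1))) < 1) \<and>
    (\<exists>\<eta> \<in> Mspace P.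
       let h = (\<lambda>n \<phi>. \<phi> + \<eta> (n, \<phi>));
           R = sol_op ev (\<lambda>m \<phi>. A m \<phi> + f m \<phi>)
       in (\<forall>m n. n \<le> m \<longrightarrow>
             (\<forall>\<phi> \<in> Fsp P n. h m (sol_op ev A m n \<phi>) = R m n (h n \<phi>))) \<and>
          (\<forall>n. inj_on (h n) (Fsp P n)))"
proof -
  interpret phase_space ev J K M by fact
  interpret dichotomy ev J K M A P D lam
    by (intro dichotomy.intro dichotomy_axioms.intro assms)
  \<comment> \<open>the summand \<open>1\<close> covers the case \<open>K 1 = 0\<close>\<close>
  define C0 where "C0 = 1 / (K 1 * green_bound + 1)"
  have pos: "K 1 * green_bound + 1 > 0"
    using K_nonneg[of 1] green_bound_pos by (simp add: add_nonneg_pos)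
  show ?thesis
  proof (intro exI[of _ C0] conjI allI impI)
    show "C0 > 0" using pos by (simp add: C0_def)
  next
    fix C :: real and f :: "nat \<Rightarrow> 'b \<Rightarrow> 'a"
    assume C: "0 < C" "C < C0" and f: "\<forall>m. f m 0 = 0"
      "\<forall>m \<phi> \<psi>. norm (f m \<phi> - f m \<psi>) \<le> C * min 1 (norm (\<phi> - \<psi>))"
    have "C * (K 1 * green_bound + 1) < 1" using C(2) pos by (simp add: C0_def pos_less_divide_eq)
    then have small: "K 1 * (C * green_bound) < 1" using C(1) by (simp add: algebra_simps)
    interpret semilinear_perturbation ev J K M A P D lam f C
      by unfold_locales (use C f small in auto)
    have le: "(\<Sum>k. C * onorm (G m (k + 1))) \<le> C * green_bound" for m
      using suminf_green_le[of m] C(1) by (simp add: suminf_mult[OF summable_green])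
    show "summable (\<lambda>k. C * onorm (G m (k + 1)))" for m
      using summable_green by (simp add: summable_mult)
    show "bdd_above (range (\<lambda>m. \<Sum>k. C * onorm (G m (k + 1))))"
      using le by (intro bdd_aboveI2)
    have "(SUP m. \<Sum>k. C * onorm (G m (k + 1))) \<le> C * green_bound"
      by (rule cSUP_least[OF UNIV_not_empty le])
    then show "K 1 * (SUP m. \<Sum>k. C * onorm (G m (k + 1))) < 1"
      using mult_left_mono[OF _ K_nonneg[of 1]] small le_less_trans by blast
    obtain \<eta> where \<eta>: "continuous_on UNIV \<eta>" "\<And>p. norm (\<eta> p) \<le> green_bound * (K 1 * C)"
      and fixpoint: "\<And>p. \<eta> p = lyapunov_perron \<eta> p"
      using lyapunov_perron_fixpoint by blast
    note conj = fixpoint_conjugates[OF fixpoint]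
    have "\<eta> \<in> Mspace P"
      unfolding Mspace_def using \<eta> by (auto intro: continuous_on_subset boundedI)
    moreover have "inj_on (\<lambda>\<phi>. \<phi> + \<eta> (n, \<phi>)) (Fsp P n)" for n
      unfolding Fsp_eq_kerP by (rule bounded_conjugacy_inj[OF conj \<eta>(2)])
    ultimately show "\<exists>\<eta>\<in>Mspace P.
       let h = (\<lambda>n \<phi>. \<phi> + \<eta> (n, \<phi>));
           R = sol_op ev (\<lambda>m \<phi>. A m \<phi> + f m \<phi>)
       in (\<forall>m n. n \<le> m \<longrightarrow>
             (\<forall>\<phi> \<in> Fsp P n. h m (sol_op ev A m n \<phi>) = R m n (h n \<phi>))) \<and>
          (\<forall>n. inj_on (h n) (Fsp P n))"
      using conj by (intro bexI[of _ \<eta>]) (auto simp: Let_def Fsp_eq_kerP)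
  qed
qed

end
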